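(* Let $\mathfrak M_i$ and $\mathfrak N_i$ ($1\le i\le k$) be $\mathsf{MSO}$-Henkin structures over $\sigma$, the $\mathfrak M_i$ with pairwise disjoint domains and the $\mathfrak N_i$ with pairwise disjoint domains. For each $i$ let $\bar a_i,\bar b_i$ be sequences of first-order parameters $a_{i_1},\ldots,a_{i_m}$ and $b_{i_1},\ldots,b_{i_m}$ (with $m$ possibly depending on $i$) in $\mathfrak M_i$, $\mathfrak N_i$ respectively, and $\bar A_i,\bar B_i$ sequences of set parameters $A_{i_1},\ldots,A_{i_{m'}}\in\mathbb A_{\mathfrak M_i}$ and $B_{i_1},\ldots,B_{i_{m'}}\in\mathbb A_{\mathfrak N_i}$. If $(\mathfrak M_i,\bar A_i,\bar a_i)\equiv^n_{\mathsf{MSO}}(\mathfrak N_i,\bar B_i,\bar b_i)$ for all $1\le i\le k$, then $$\Big(\bigoplus^f_{1\le i\le k}\mathfrak M_i,(\bar A_1,\ldots,\bar A_k)^\cup,\bar a_1,\ldots,\bar a_k\Big)\equiv^n_{\mathsf{MSO}}\Big(\bigoplus^f_{1\le i\le k}\mathfrak N_i,(\bar B_1,\ldots,\bar B_k)^\cup,\bar b_1,\ldots,\bar b_k\Big).$$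
   Context: Henkin semantics for $\mathsf{MSO}$: a frame is a relational structure $\mathfrak M$ with a set $\mathbb A_{\mathfrak M}$ of admissible subsets over which set variables and set quantifiers range; an $\mathsf{MSO}$-Henkin structure is a frame such that every set $\{a:\mathfrak M,g[a/x]\models\varphi\}$ ($\varphi$ an $\mathsf{MSO}$-formula, $g$ an assignment) is admissible. Parametrized structures $(\mathfrak M,\bar A,\bar a)$ interpret additional unary predicates/constants by the set parameters $\bar A$ and element parameters $\bar a$; $\equiv^n_{\mathsf{MSO}}$ means satisfying the same $\mathsf{MSO}$-formulas of quantifier depth at most $n$ (depth counts nested first-order and set quantifiers), with parameters in corresponding positions interpreted correspondingly. Fusion. Let $\sigma$ be a purely relational vocabulary and $\sigma^*=\sigma\cup\{Q_1,\ldots,Q_k\}$ with new unary predicates $Q_i$. Let $f$ map each $n$-ary $P\in\sigma$ to a quantifier-free first-order $\sigma^*$-formula in variables $x_1,\ldots,x_n$. For Henkin structures $\mathfrak M_1,\ldots,\mathfrak M_k$ with pairwise disjoint domains, the disjoint union $\biguplus_i\mathfrak M_i$ is the $\sigma^*$-frame with domain $\bigcup_i dom(\mathfrak M_i)$, $P$ interpreted as $\bigcup_iP^{\mathfrak M_i}$ for $P\in\sigma$, $Q_i$ interpreted as $dom(\mathfrak M_i)$, and admissible sets exactly the sets $\bigcup_iA_i$ with $A_i\in\mathbb A_{\mathfrak M_i}$. The $f$-fusion $\bigoplus^f_i\mathfrak M_i$ is the $\sigma$-frame with the same domain and admissible sets as $\biguplus_i\mathfrak M_i$, where each $P\in\sigma$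 is interpreted as the set of tuples satisfying $f(P)$ in $\biguplus_i\mathfrak M_i$. For a finite sequence of set parameters $A_1,\ldots,A_k$, $(A_1,\ldots,A_k)^\cup$ is the finite sequence of all unions $\bigcup_{i\in I}A_i$ for $I\subseteq\{1,\ldots,k\}$, ordered in a fixed canonical way depending on the index sets $I$ (the same ordering used on both sides). *)

theory Defs
  imports Main "HOL-Library.Disjoint_Sets"
begin

record 'p vocab =
  preds :: "'p set"
  arity :: "'p \<Rightarrow> nat"

record ('p, 'a) frame =
  universe :: "'a set"
  interp :: "'p \<Rightarrow> 'a list set"
  admissible :: "'a set set"

text \<open>
  The set of admissible sets is required to be non-empty: otherwise there would be no
  assignment at all, and closure under definability would hold vacuously.
\<close>

definition is_frame :: "'p vocab \<Rightarrow> ('p, 'a) frame \<Rightarrow> bool" where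
  "is_frame \<sigma> M \<longleftrightarrow>
     universe M \<noteq> {} \<and>
     (\<forall>P\<in>preds \<sigma>. \<forall>xs\<in>interp M P. length xs = arity \<sigma> P \<and> set xs \<subseteq> universe M) \<and>
     admissible M \<noteq> {} \<and>
     admissible M \<subseteq> Pow (universe M)"

text \<open>
  The syntax contains, besides the predicate symbols, individual constants \<open>Cst j\<close> and unary
  predicates \<open>SetCst j\<close> that name the element and set parameters of a parametrized structure;
  the formulas over a vocabulary proper are those that use neither. First-order
  variables and set variables are two separate sorts, both named by natural numbers.
\<close>

datatype trm = Var nat | Cst nat

datatype 'p fm =
    Bot
  | Rel 'p "trm list"
  | Eq trm trm
  | SetCst nat trm
  | SetVar nat trm
  | Neg "'p fm"
  | Conj "'p fm" "'p fm"
  | Ex nat "'p fm"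
  | ExSet nat "'p fm"

primrec wf_trm :: "nat \<Rightarrow> trm \<Rightarrow> bool" where
  "wf_trm m (Var x) \<longleftrightarrow> True"
| "wf_trm m (Cst j) \<longleftrightarrow> j < m"

text \<open>
  \<open>mso_fm \<sigma> m' m \<phi>\<close>: \<open>\<phi>\<close> is an MSO-formula over \<open>\<sigma>\<close> expanded by \<open>m'\<close> unary predicates and
  \<open>m\<close> individual constants.
\<close>

primrec mso_fm :: "'p vocab \<Rightarrow> nat \<Rightarrow> nat \<Rightarrow> 'p fm \<Rightarrow> bool" where
  "mso_fm \<sigma> m' m Bot \<longleftrightarrow> True"
| "mso_fm \<sigma> m' m (Rel P ts) \<longleftrightarrow>
     P \<in> preds \<sigma> \<and> length ts = arity \<sigma> P \<and> (\<forall>t\<in>set ts. wf_trm m t)"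
| "mso_fm \<sigma> m' m (Eq s t) \<longleftrightarrow> wf_trm m s \<and> wf_trm m t"
| "mso_fm \<sigma> m' m (SetCst j t) \<longleftrightarrow> j < m' \<and> wf_trm m t"
| "mso_fm \<sigma> m' m (SetVar X t) \<longleftrightarrow> wf_trm m t"
| "mso_fm \<sigma> m' m (Neg \<phi>) \<longleftrightarrow> mso_fm \<sigma> m' m \<phi>"
| "mso_fm \<sigma> m' m (Conj \<phi> \<psi>) \<longleftrightarrow> mso_fm \<sigma> m' m \<phi> \<and> mso_fm \<sigma> m' m \<psi>"
| "mso_fm \<sigma> m' m (Ex x \<phi>) \<longleftrightarrow> mso_fm \<sigma> m' m \<phi>"
| "mso_fm \<sigma> m' m (ExSet X \<phi>) \<longleftrightarrow> mso_fm \<sigma> m' m \<phi>"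

primrec qdepth :: "'p fm \<Rightarrow> nat" where
  "qdepth Bot = 0"
| "qdepth (Rel P ts) = 0"
| "qdepth (Eq s t) = 0"
| "qdepth (SetCst j t) = 0"
| "qdepth (SetVar X t) = 0"
| "qdepth (Neg \<phi>) = qdepth \<phi>"
| "qdepth (Conj \<phi> \<psi>) = max (qdepth \<phi>) (qdepth \<psi>)"
| "qdepth (Ex x \<phi>) = Suc (qdepth \<phi>)"
| "qdepth (ExSet X \<phi>) = Suc (qdepth \<phi>)"

primrec first_order :: "'p fm \<Rightarrow> bool" where
  "first_order Bot \<longleftrightarrow> True"
| "first_order (Rel P ts) \<longleftrightarrow> True"
| "first_order (Eq s t) \<longleftrightarrow> True"
| "first_order (SetCst j t) \<longleftrightarrow> True"
| "first_order (SetVar X t) \<longleftrightarrow> False"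
| "first_order (Neg \<phi>) \<longleftrightarrow> first_order \<phi>"
| "first_order (Conj \<phi> \<psi>) \<longleftrightarrow> first_order \<phi> \<and> first_order \<psi>"
| "first_order (Ex x \<phi>) \<longleftrightarrow> first_order \<phi>"
| "first_order (ExSet X \<phi>) \<longleftrightarrow> False"

primrec vars_trm :: "trm \<Rightarrow> nat set" where
  "vars_trm (Var x) = {x}"
| "vars_trm (Cst j) = {}"

primrec free_vars :: "'p fm \<Rightarrow> nat set" where
  "free_vars Bot = {}"
| "free_vars (Rel P ts) = (\<Union>t\<in>set ts. vars_trm t)"
| "free_vars (Eq s t) = vars_trm s \<union> vars_trm t"
| "free_vars (SetCst j t) = vars_trm t"
| "free_vars (SetVar X t) = vars_trm t"
| "free_vars (Neg \<phi>) = free_vars \<phi>"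
| "free_vars (Conj \<phi> \<psi>) = free_vars \<phi> \<union> free_vars \<psi>"
| "free_vars (Ex x \<phi>) = free_vars \<phi> - {x}"
| "free_vars (ExSet X \<phi>) = free_vars \<phi>"

primrec free_set_vars :: "'p fm \<Rightarrow> nat set" where
  "free_set_vars Bot = {}"
| "free_set_vars (Rel P ts) = {}"
| "free_set_vars (Eq s t) = {}"
| "free_set_vars (SetCst j t) = {}"
| "free_set_vars (SetVar X t) = {X}"
| "free_set_vars (Neg \<phi>) = free_set_vars \<phi>"
| "free_set_vars (Conj \<phi> \<psi>) = free_set_vars \<phi> \<union> free_set_vars \<psi>"
| "free_set_vars (Ex x \<phi>) = free_set_vars \<phi>"
| "free_set_vars (ExSet X \<phi>) = free_set_vars \<phi> - {X}"

definition sentence :: "'p fm \<Rightarrow> bool" where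
  "sentence \<phi> \<longleftrightarrow> free_vars \<phi> = {} \<and> free_set_vars \<phi> = {}"

primrec trm_val :: "'a list \<Rightarrow> (nat \<Rightarrow> 'a) \<Rightarrow> trm \<Rightarrow> 'a" where
  "trm_val as g (Var x) = g x"
| "trm_val as g (Cst j) = as ! j"

text \<open>
  Satisfaction in the parametrized structure \<open>(M, As, as)\<close>; an assignment is split into its
  first-order part \<open>g\<close> and its set part \<open>G\<close>.
\<close>

primrec sat ::
  "('p, 'a) frame \<Rightarrow> 'a set list \<Rightarrow> 'a list \<Rightarrow> (nat \<Rightarrow> 'a) \<Rightarrow> (nat \<Rightarrow> 'a set) \<Rightarrow> 'p fm \<Rightarrow> bool"
where
  "sat M As as g G Bot \<longleftrightarrow> False"
| "sat M As as g G (Rel P ts) \<longleftrightarrow> map (trm_val as g) ts \<in> interp M P"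
| "sat M As as g G (Eq s t) \<longleftrightarrow> trm_val as g s = trm_val as g t"
| "sat M As as g G (SetCst j t) \<longleftrightarrow> trm_val as g t \<in> As ! j"
| "sat M As as g G (SetVar X t) \<longleftrightarrow> trm_val as g t \<in> G X"
| "sat M As as g G (Neg \<phi>) \<longleftrightarrow> \<not> sat M As as g G \<phi>"
| "sat M As as g G (Conj \<phi> \<psi>) \<longleftrightarrow> sat M As as g G \<phi> \<and> sat M As as g G \<psi>"
| "sat M As as g G (Ex x \<phi>) \<longleftrightarrow> (\<exists>a\<in>universe M. sat M As as (g(x := a)) G \<phi>)"
| "sat M As as g G (ExSet X \<phi>) \<longleftrightarrow> (\<exists>A\<in>admissible M. sat M As as g (G(X := A)) \<phi>)"

definition assignment ::
  "('p, 'a) frame \<Rightarrow> (nat \<Rightarrow> 'a) \<Rightarrow> (nat \<Rightarrow> 'a set) \<Rightarrow> bool" where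
  "assignment M g G \<longleftrightarrow> (\<forall>x. g x \<in> universe M) \<and> (\<forall>X. G X \<in> admissible M)"

definition mso_henkin :: "'p vocab \<Rightarrow> ('p, 'a) frame \<Rightarrow> bool" where
  "mso_henkin \<sigma> M \<longleftrightarrow>
     is_frame \<sigma> M \<and>
     (\<forall>\<phi> x g G. mso_fm \<sigma> 0 0 \<phi> \<longrightarrow> assignment M g G \<longrightarrow>
        {a \<in> universe M. sat M [] [] (g(x := a)) G \<phi>} \<in> admissible M)"

type_synonym ('p, 'a) pstruct = "('p, 'a) frame \<times> 'a set list \<times> 'a list"

fun models :: "('p, 'a) pstruct \<Rightarrow> 'p fm \<Rightarrow> bool" where
  "models (M, As, as) \<phi> \<longleftrightarrow> (\<forall>g G. assignment M g G \<longrightarrow> sat M As as g G \<phi>)"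

fun mso_equiv :: "'p vocab \<Rightarrow> nat \<Rightarrow> ('p, 'a) pstruct \<Rightarrow> ('p, 'b) pstruct \<Rightarrow> bool" where
  "mso_equiv \<sigma> n (M, As, as) (N, Bs, bs) \<longleftrightarrow>
     length As = length Bs \<and> length as = length bs \<and>
     (\<forall>\<phi>. mso_fm \<sigma> (length As) (length as) \<phi> \<and> sentence \<phi> \<and> qdepth \<phi> \<le> n \<longrightarrow>
        (models (M, As, as) \<phi> \<longleftrightarrow> models (N, Bs, bs) \<phi>))"

text \<open>
  In the vocabulary \<open>\<sigma>\<^sup>*\<close> the symbol \<open>Inl P\<close> is \<open>P\<close> itself and \<open>Inr i\<close> is the
  new unary predicate \<open>Q\<^sub>i\<close>, for \<open>i\<close> from \<open>1\<close> to \<open>k\<close>.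
\<close>

definition star_vocab :: "'p vocab \<Rightarrow> nat \<Rightarrow> ('p + nat) vocab" where
  "star_vocab \<sigma> k =
     \<lparr> preds = Inl ` preds \<sigma> \<union> Inr ` {1..k}, arity = case_sum (arity \<sigma>) (\<lambda>_. 1) \<rparr>"

definition disjoint_union :: "nat \<Rightarrow> (nat \<Rightarrow> ('p, 'a) frame) \<Rightarrow> ('p + nat, 'a) frame" where
  "disjoint_union k M =
     \<lparr> universe = (\<Union>i\<in>{1..k}. universe (M i)),
       interp = case_sum (\<lambda>P. \<Union>i\<in>{1..k}. interp (M i) P) (\<lambda>i. {[a] |a. a \<in> universe (M i)}),
       admissible = {\<Union>i\<in>{1..k}. A i |A. \<forall>i\<in>{1..k}. A i \<in> admissible (M i)} \<rparr>"

text \<open>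
  The variables \<open>x\<^sub>1, \<dots>, x\<^sub>n\<close> of the formula \<open>f P\<close> are \<open>Var 0, \<dots>, Var (n - 1)\<close>, so that the
  tuple \<open>xs\<close> corresponds to the assignment \<open>(!) xs\<close>. The set part of the assignment is
  irrelevant, as \<open>f P\<close> is first-order.
\<close>

definition fusion_map :: "'p vocab \<Rightarrow> nat \<Rightarrow> ('p \<Rightarrow> ('p + nat) fm) \<Rightarrow> bool" where
  "fusion_map \<sigma> k f \<longleftrightarrow>
     (\<forall>P\<in>preds \<sigma>. mso_fm (star_vocab \<sigma> k) 0 0 (f P) \<and> first_order (f P) \<and>
        qdepth (f P) = 0 \<and> free_vars (f P) \<subseteq> {..<arity \<sigma> P})"

definition fusion ::
  "'p vocab \<Rightarrow> nat \<Rightarrow> ('p \<Rightarrow> ('p + nat) fm) \<Rightarrow> (nat \<Rightarrow> ('p, 'a) frame) \<Rightarrow> ('p, 'a) frame" where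
  "fusion \<sigma> k f M =
     \<lparr> universe = universe (disjoint_union k M),
       interp = (\<lambda>P. {xs. length xs = arity \<sigma> P \<and> set xs \<subseteq> universe (disjoint_union k M) \<and>
                         sat (disjoint_union k M) [] [] ((!) xs) (\<lambda>_. {}) (f P)}),
       admissible = admissible (disjoint_union k M) \<rparr>"

text \<open>
  All unions of subfamilies of a finite sequence of sets, the index sets \<open>I\<close> being listed in
  the order given by \<^const>\<open>subseqs\<close>, which depends on the length of the sequence only.
\<close>

definition all_unions :: "'a set list \<Rightarrow> 'a set list" where
  "all_unions As = map (\<lambda>I. \<Union>j\<in>set I. As ! j) (subseqs [0..<length As])"

definition seq_concat :: "nat \<Rightarrow> (nat \<Rightarrow> 'c list) \<Rightarrow> 'c list" where
  "seq_concat k s = concat (map s [1..<Suc k])"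

end

theory Submission
  imports Defs
begin

text \<open>
  A Feferman--Vaught argument. Expanding each \<open>P\<close> to \<open>f P\<close> reduces fusions to disjoint unions
  without changing the quantifier depth. Over a disjoint union, once every free first-order variable
  is assigned to a component, a formula is equivalent to a finite disjunction of rows \<open>r\<close>, where
  a row holds if each component \<open>i\<close> satisfies \<open>r i\<close>. A set quantifier distributes over
  a row, since an admissible set is an independent choice of admissible sets in the components; an
  element quantifier splits according to the component of the witness, and touches only the entry of
  that component. The rows depend on the formula and on the numbers of parameters only, and are no
  deeper than the formula. Unlike in a game argument, the vocabulary may be infinite.
\<close>

subsection \<open>Sentences\<close>

lemma trm_val_cong: "(\<And>x. x \<in> vars_trm t \<Longrightarrow> g x = h x) \<Longrightarrow> trm_val as g t = trm_val as h t"
  by (cases t) auto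

lemma sat_cong:
  assumes "\<And>x. x \<in> free_vars \<phi> \<Longrightarrow> g x = h x" "\<And>X. X \<in> free_set_vars \<phi> \<Longrightarrow> G X = H X"
  shows "sat M As as g G \<phi> \<longleftrightarrow> sat M As as h H \<phi>"
  using assms
proof (induction \<phi> arbitrary: g h G H)
  case (Rel P ts)
  then have "map (trm_val as g) ts = map (trm_val as h) ts"
    by (auto intro!: trm_val_cong)
  then show ?case by (simp only: sat.simps)
next
  case (Eq s t)
  then have "trm_val as g s = trm_val as h s" "trm_val as g t = trm_val as h t"
    by (auto intro!: trm_val_cong)
  then show ?case by simp
next
  case (SetCst j t)
  then have "trm_val as g t = trm_val as h t"
    by (auto intro!: trm_val_cong)
  then show ?case by simp
next
  case (SetVar X t)
  then have "trm_val as g t = trm_val as h t"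
    by (auto intro!: trm_val_cong)
  with SetVar show ?case by simp
next
  case (Conj \<phi> \<psi>)
  have "sat M As as g G \<phi> = sat M As as h H \<phi>" "sat M As as g G \<psi> = sat M As as h H \<psi>"
    by (intro Conj.IH; simp add: Conj.prems)+
  then show ?case by simp
next
  case (Ex x \<phi>)
  have "sat M As as (g(x := e)) G \<phi> = sat M As as (h(x := e)) H \<phi>" for e
    by (intro Ex.IH) (use Ex.prems in auto)
  then show ?case by simp
next
  case (ExSet X \<phi>)
  have "sat M As as g (G(X := E)) \<phi> = sat M As as h (H(X := E)) \<phi>" for E
    by (intro ExSet.IH) (use ExSet.prems in auto)
  then show ?case by simp
next
  case (Neg \<phi>)
  have "sat M As as g G \<phi> = sat M As as h H \<phi>"
    by (intro Neg.IH) (use Neg.prems in auto)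
  then show ?case by simp
qed simp

text \<open>A sentence has the same truth value under all \<open>g\<close> and \<open>G\<close>.
  Non-emptiness supplies at least one assignment, so the universal quantifier in
  \<open>models\<close> is not vacuous and one evaluation decides it.\<close>

lemma models_sentence:
  assumes "universe M \<noteq> {}" "admissible M \<noteq> {}" "sentence \<phi>"
  shows "models (M, As, as) \<phi> \<longleftrightarrow> sat M As as g G \<phi>"
proof -
  obtain e E where "e \<in> universe M" "E \<in> admissible M" using assms by blast
  then have "assignment M (\<lambda>_. e) (\<lambda>_. E)" by (simp add: assignment_def)
  moreover have "sat M As as h H \<phi> \<longleftrightarrow> sat M As as g G \<phi>" for h H
    by (rule sat_cong) (use assms(3) in \<open>auto simp: sentence_def\<close>)
  ultimately show ?thesis by auto
qed

subsection \<open>From the fusion to the disjoint union\<close>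

primrec subst_trm :: "trm list \<Rightarrow> trm \<Rightarrow> trm" where
  "subst_trm ts (Var x) = ts ! x"
| "subst_trm ts (Cst j) = Cst j"

text \<open>Capture-avoidance is not an issue: only quantifier-free formulas are substituted into.\<close>

primrec subst_qf :: "trm list \<Rightarrow> 'q fm \<Rightarrow> 'q fm" where
  "subst_qf ts Bot = Bot"
| "subst_qf ts (Rel P us) = Rel P (map (subst_trm ts) us)"
| "subst_qf ts (Eq s t) = Eq (subst_trm ts s) (subst_trm ts t)"
| "subst_qf ts (SetCst j t) = SetCst j (subst_trm ts t)"
| "subst_qf ts (SetVar X t) = SetVar X (subst_trm ts t)"
| "subst_qf ts (Neg \<phi>) = Neg (subst_qf ts \<phi>)"
| "subst_qf ts (Conj \<phi> \<psi>) = Conj (subst_qf ts \<phi>) (subst_qf ts \<psi>)"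
| "subst_qf ts (Ex x \<phi>) = Ex x \<phi>"
| "subst_qf ts (ExSet X \<phi>) = ExSet X \<phi>"

primrec expand :: "('p \<Rightarrow> 'q fm) \<Rightarrow> 'p fm \<Rightarrow> 'q fm" where
  "expand f Bot = Bot"
| "expand f (Rel P ts) = subst_qf ts (f P)"
| "expand f (Eq s t) = Eq s t"
| "expand f (SetCst j t) = SetCst j t"
| "expand f (SetVar X t) = SetVar X t"
| "expand f (Neg \<phi>) = Neg (expand f \<phi>)"
| "expand f (Conj \<phi> \<psi>) = Conj (expand f \<phi>) (expand f \<psi>)"
| "expand f (Ex x \<phi>) = Ex x (expand f \<phi>)"
| "expand f (ExSet X \<phi>) = ExSet X (expand f \<phi>)"

lemma trm_val_subst_trm:
  assumes "wf_trm 0 t" "vars_trm t \<subseteq> {..<length ts}"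
  shows "trm_val as g (subst_trm ts t) = trm_val [] ((!) (map (trm_val as g) ts)) t"
  using assms by (cases t) auto

text \<open>The right-hand side has the shape of the clause for \<open>interp\<close> in
  \<open>fusion\<close>: no parameters, and the tuple of values itself as assignment. Since \<phi>
  has neither constants nor set variables nor quantifiers, only the values of the terms
  \<open>ts\<close> matter and \<open>H\<close> is arbitrary.\<close>

lemma sat_subst_qf:
  assumes "mso_fm \<tau> 0 0 \<phi>" "first_order \<phi>" "qdepth \<phi> = 0" "free_vars \<phi> \<subseteq> {..<length ts}"
  shows "sat D As as g G (subst_qf ts \<phi>) \<longleftrightarrow> sat D [] [] ((!) (map (trm_val as g) ts)) H \<phi>"
  using assms
proof (induction \<phi>)
  case (Rel P us)
  then have "map (trm_val as g) (map (subst_trm ts) us)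
      = map (trm_val [] ((!) (map (trm_val as g) ts))) us"
    by (auto intro!: trm_val_subst_trm)
  then show ?case by (simp only: subst_qf.simps sat.simps)
qed (auto simp: trm_val_subst_trm)

lemma wf_subst_trm:
  assumes "wf_trm 0 t" "vars_trm t \<subseteq> {..<length ts}" "\<forall>u\<in>set ts. wf_trm m u"
  shows "wf_trm m (subst_trm ts t)"
  using assms by (cases t) auto

lemma vars_subst_trm:
  assumes "wf_trm 0 t" "vars_trm t \<subseteq> {..<length ts}"
  shows "vars_trm (subst_trm ts t) \<subseteq> (\<Union>u\<in>set ts. vars_trm u)"
  using assms by (cases t) force+

lemma subst_qf_syntax:
  assumes "mso_fm \<tau> 0 0 \<phi>" "first_order \<phi>" "qdepth \<phi> = 0" "free_vars \<phi> \<subseteq> {..<length ts}"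
    and "\<forall>u\<in>set ts. wf_trm m u"
  shows "mso_fm \<tau> m' m (subst_qf ts \<phi>) \<and> qdepth (subst_qf ts \<phi>) = 0 \<and>
    free_vars (subst_qf ts \<phi>) \<subseteq> (\<Union>u\<in>set ts. vars_trm u) \<and> free_set_vars (subst_qf ts \<phi>) = {}"
  using assms
proof (induction \<phi>)
  case (Rel P us)
  then have "wf_trm 0 u" "vars_trm u \<subseteq> {..<length ts}" if "u \<in> set us" for u
    using that by auto
  with Rel show ?case
    using wf_subst_trm[of _ ts m] vars_subst_trm[of _ ts] by (simp add: UN_subset_iff)
next
  case (Eq s t)
  then show ?case
    using wf_subst_trm[of _ ts m] vars_subst_trm[of _ ts] by simp
qed simp_all

text \<open>Each \<open>f P\<close> is quantifier-free, so replacing atoms leaves the depth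
  unchanged. The variables satisfy inclusions only, because \<open>f P\<close> may ignore some of
  its arguments.\<close>

lemma expand_syntax:
  assumes "fusion_map \<sigma> k f" "mso_fm \<sigma> m' m \<phi>"
  shows "mso_fm (star_vocab \<sigma> k) m' m (expand f \<phi>) \<and> qdepth (expand f \<phi>) = qdepth \<phi> \<and>
    free_vars (expand f \<phi>) \<subseteq> free_vars \<phi> \<and> free_set_vars (expand f \<phi>) \<subseteq> free_set_vars \<phi>"
  using assms(2)
proof (induction \<phi>)
  case (Rel P ts)
  then show ?case
    using subst_qf_syntax[of "star_vocab \<sigma> k" "f P" ts m m'] assms(1)
    by (simp add: fusion_map_def)
qed auto

lemma trm_val_mem:
  assumes "wf_trm (length as) t" "set as \<subseteq> U" "\<forall>x. g x \<in> U"
  shows "trm_val as g t \<in> U"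
  using assms by (cases t) auto

text \<open>The relations of the fusion contain only tuples over its universe, so all values of
  terms have to stay inside it. Both frames have the same universe and admissible sets, so the
  quantifiers range over the same objects.\<close>

lemma sat_fusion:
  assumes "fusion_map \<sigma> k f" "mso_fm \<sigma> m' (length as) \<phi>"
    and "set as \<subseteq> universe (disjoint_union k M)" "\<forall>x. g x \<in> universe (disjoint_union k M)"
  shows "sat (fusion \<sigma> k f M) As as g G \<phi> \<longleftrightarrow> sat (disjoint_union k M) As as g G (expand f \<phi>)"
  using assms(2,4)
proof (induction \<phi> arbitrary: g G)
  case (Rel P ts)
  have "set (map (trm_val as g) ts) \<subseteq> universe (disjoint_union k M)"
    using Rel assms(3) trm_val_mem[of as _ "universe (disjoint_union k M)" g] by auto
  moreover have "sat (disjoint_union k M) As as g G (subst_qf ts (f P)) \<longleftrightarrow>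
      sat (disjoint_union k M) [] [] ((!) (map (trm_val as g) ts)) (\<lambda>_. {}) (f P)"
    using Rel assms(1)
    by (intro sat_subst_qf[of "star_vocab \<sigma> k"]) (auto simp: fusion_map_def)
  ultimately show ?case using Rel by (simp add: fusion_def)
next
  case (Ex x \<phi>)
  have "universe (fusion \<sigma> k f M) = universe (disjoint_union k M)" by (simp add: fusion_def)
  moreover have "sat (fusion \<sigma> k f M) As as (g(x := e)) G \<phi> \<longleftrightarrow>
      sat (disjoint_union k M) As as (g(x := e)) G (expand f \<phi>)"
    if "e \<in> universe (disjoint_union k M)" for e
    using Ex that by simp
  ultimately show ?case by auto
next
  case (ExSet X \<phi>)
  have "admissible (fusion \<sigma> k f M) = admissible (disjoint_union k M)" by (simp add: fusion_def)
  with ExSet show ?case by simp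
qed simp_all

subsection \<open>Addresses of parameters\<close>

text \<open>Entry \<open>j\<close> tells from which component, and from which position there, the
  \<open>j\<close>-th member of a concatenation comes. It depends on the lengths alone, so two
  families with matching parameters share it.\<close>

definition address_list :: "nat \<Rightarrow> (nat \<Rightarrow> nat) \<Rightarrow> (nat \<times> nat) list" where
  "address_list k l = seq_concat k (\<lambda>i. map (Pair i) [0..<l i])"

lemma seq_concat_address:
  "seq_concat k s = map (\<lambda>(i, j). s i ! j) (address_list k (\<lambda>i. length (s i)))"
proof -
  have "s i = map (\<lambda>(i, j). s i ! j) (map (Pair i) [0..<length (s i)])" for i
    by (simp add: comp_def map_nth)
  then show ?thesis
    unfolding address_list_def seq_concat_def map_concat map_map comp_def by metis
qed

lemma length_address_list: "length (seq_concat k s) = length (address_list k (\<lambda>i. length (s i)))"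
  by (subst seq_concat_address) simp

lemma set_address_list: "set (address_list k l) = (SIGMA i:{1..k}. {..<l i})"
  by (auto simp: address_list_def seq_concat_def)

lemma nth_address_list:
  assumes "j < length (address_list k l)"
  shows "fst (address_list k l ! j) \<in> {1..k}"
    and "snd (address_list k l ! j) < l (fst (address_list k l ! j))"
  using nth_mem[OF assms] by (auto simp: set_address_list mem_Sigma_iff split_beta)

lemma seq_concat_nth:
  assumes "j < length (seq_concat k s)"
  shows "seq_concat k s ! j = (case address_list k (\<lambda>i. length (s i)) ! j of (i, j') \<Rightarrow> s i ! j')"
  using assms by (subst seq_concat_address) (simp add: length_address_list)

definition union_addresses :: "nat \<Rightarrow> (nat \<Rightarrow> nat) \<Rightarrow> nat \<Rightarrow> (nat \<times> nat) list" where
  "union_addresses k l q =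
     map ((!) (address_list k l)) (subseqs [0..<length (address_list k l)] ! q)"

lemma set_union_addresses:
  assumes "q < length (subseqs [0..<length (address_list k l)])"
  shows "set (union_addresses k l q) \<subseteq> (SIGMA i:{1..k}. {..<l i})"
proof -
  let ?n = "length (address_list k l)"
  have "set (subseqs [0..<?n] ! q) \<in> Pow (set [0..<?n])"
    unfolding subseqs_powset[symmetric] using assms by simp
  then have "set (subseqs [0..<?n] ! q) \<subseteq> {..<?n}" by auto
  then have "set (union_addresses k l q) \<subseteq> set (address_list k l)"
    by (auto simp: union_addresses_def)
  then show ?thesis by (simp add: set_address_list)
qed

text \<open>This reduces membership in a set named by \<open>SetCst q\<close> to membership in one
  of finitely many original parameters, each belonging to a known component.\<close>

lemma all_unions_nth:
  assumes "q < length (all_unions (seq_concat k s))"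
  shows "all_unions (seq_concat k s) ! q
    = (\<Union>(i, j)\<in>set (union_addresses k (\<lambda>i. length (s i)) q). s i ! j)"
proof -
  let ?L = "address_list k (\<lambda>i. length (s i))"
  let ?J = "set (subseqs [0..<length ?L] ! q)"
  have q: "q < length (subseqs [0..<length ?L])"
    using assms by (simp add: all_unions_def length_address_list)
  have "?J \<in> Pow (set [0..<length ?L])"
    unfolding subseqs_powset[symmetric] using q by simp
  then have "seq_concat k s ! j = (case ?L ! j of (i, j') \<Rightarrow> s i ! j')" if "j \<in> ?J" for j
    using that by (intro seq_concat_nth) (auto simp: length_address_list)
  then show ?thesis
    using q by (simp add: all_unions_def length_address_list union_addresses_def)
qed

subsection \<open>Decomposition of formulas over a disjoint union\<close>

primrec trm_loc :: "(nat \<times> nat) list \<Rightarrow> (nat \<Rightarrow> nat) \<Rightarrow> trm \<Rightarrow> nat" where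
  "trm_loc p c (Var x) = c x"
| "trm_loc p c (Cst j) = fst (p ! j)"

text \<open>Variables keep their names, since all components will share one element assignment. Its
  values may lie outside a given component, which is why the location of every variable is tracked
  by \<open>c\<close>.\<close>

primrec trm_proj :: "(nat \<times> nat) list \<Rightarrow> trm \<Rightarrow> trm" where
  "trm_proj p (Var x) = Var x"
| "trm_proj p (Cst j) = Cst (snd (p ! j))"

definition only :: "nat \<Rightarrow> 'p fm \<Rightarrow> nat \<Rightarrow> 'p fm" where
  "only i \<psi> j = (if j = i then \<psi> else Neg Bot)"

text \<open>
  A list of rows stands for a disjunction of conjunctions over the components, so its negation has
  one row for each way of choosing a failing component in every row.
\<close>

primrec neg_rows :: "nat \<Rightarrow> (nat \<Rightarrow> 'p fm) list \<Rightarrow> (nat \<Rightarrow> 'p fm) list" where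
  "neg_rows k [] = [\<lambda>_. Neg Bot]"
| "neg_rows k (r # rs) =
     [\<lambda>j. Conj (only i (Neg (r i)) j) (s j). i \<leftarrow> [1..<Suc k], s \<leftarrow> neg_rows k rs]"

text \<open>
  Here \<open>p\<close> lists the addresses of the constants, \<open>I q\<close> the addresses of the sets whose union is
  named by \<open>SetCst q\<close>, and \<open>c\<close> gives the component in which each variable takes its value.
\<close>

primrec decomp :: "nat \<Rightarrow> (nat \<times> nat) list \<Rightarrow> (nat \<Rightarrow> (nat \<times> nat) list) \<Rightarrow>
    ('p + nat) fm \<Rightarrow> (nat \<Rightarrow> nat) \<Rightarrow> (nat \<Rightarrow> 'p fm) list" where
  "decomp k p I Bot c = []"
| "decomp k p I (Rel P ts) c =
     (case P of
        Inl Q \<Rightarrow> [only i (Rel Q (map (trm_proj p) ts)).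
                   i \<leftarrow> [1..<Suc k], \<forall>t\<in>set ts. trm_loc p c t = i]
      | Inr i \<Rightarrow> if \<forall>t\<in>set ts. trm_loc p c t = i then [\<lambda>_. Neg Bot] else [])"
| "decomp k p I (Eq s t) c =
     (if trm_loc p c s = trm_loc p c t
      then [only (trm_loc p c s) (Eq (trm_proj p s) (trm_proj p t))] else [])"
| "decomp k p I (SetCst q t) c =
     [only (trm_loc p c t) (SetCst (snd u) (trm_proj p t)). u \<leftarrow> I q, fst u = trm_loc p c t]"
| "decomp k p I (SetVar X t) c = [only (trm_loc p c t) (SetVar X (trm_proj p t))]"
| "decomp k p I (Neg \<phi>) c = neg_rows k (decomp k p I \<phi> c)"
| "decomp k p I (Conj \<phi> \<psi>) c =
     [\<lambda>i. Conj (r i) (s i). r \<leftarrow> decomp k p I \<phi> c, s \<leftarrow> decomp k p I \<psi> c]"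
| "decomp k p I (Ex x \<phi>) c =
     [r(i := Ex x (r i)). i \<leftarrow> [1..<Suc k], r \<leftarrow> decomp k p I \<phi> (c(x := i))]"
| "decomp k p I (ExSet X \<phi>) c = [\<lambda>i. ExSet X (r i). r \<leftarrow> decomp k p I \<phi> c]"

section \<open>Syntactic bounds on the rows\<close>

text \<open>The vocabulary and the depth are what equivalence up to depth \<open>n\<close> asks for.
  \<open>V\<close> confines an entry to the variables located in its component, and \<open>V\<close>
  and \<open>W\<close> together show that sentences yield sentences.\<close>

definition fm_bound ::
  "'p vocab \<Rightarrow> nat \<Rightarrow> nat \<Rightarrow> nat \<Rightarrow> nat set \<Rightarrow> nat set \<Rightarrow> 'p fm \<Rightarrow> bool" where
  "fm_bound \<sigma> m' m d V W \<psi> \<longleftrightarrow> mso_fm \<sigma> m' m \<psi> \<and> qdepth \<psi> \<le> d \<and>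
     free_vars \<psi> \<subseteq> V \<and> free_set_vars \<psi> \<subseteq> W"

lemma neg_rows_bound:
  assumes "\<forall>r\<in>set rs. \<forall>i\<in>{1..k}. fm_bound \<sigma> (m' i) (m i) d (V i) W (r i)"
  shows "\<forall>r\<in>set (neg_rows k rs). \<forall>i\<in>{1..k}. fm_bound \<sigma> (m' i) (m i) d (V i) W (r i)"
  using assms
proof (induction rs)
  case Nil
  then show ?case by (simp add: fm_bound_def)
next
  case (Cons r rs)
  show ?case
  proof (intro ballI)
    fix u i
    assume "u \<in> set (neg_rows k (r # rs))" and i: "i \<in> {1..k}"
    then obtain j s where u: "u = (\<lambda>i. Conj (only j (Neg (r j)) i) (s i))"
      and s: "s \<in> set (neg_rows k rs)"
      by (auto simp del: upt_Suc)
    have "fm_bound \<sigma> (m' i) (m i) d (V i) W (s i)" "fm_bound \<sigma> (m' i) (m i) d (V i) W (r i)"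
      using Cons s i by simp_all
    then show "fm_bound \<sigma> (m' i) (m i) d (V i) W (u i)"
      by (auto simp: u only_def fm_bound_def)
  qed
qed

lemma trm_proj_wf:
  assumes "wf_trm (length (address_list k l)) t" "\<And>x. c x \<in> {1..k}"
  shows "trm_loc (address_list k l) c t \<in> {1..k}"
    and "wf_trm (l (trm_loc (address_list k l) c t)) (trm_proj (address_list k l) t)"
proof (atomize(full), cases t)
  case (Cst j)
  then have "j < length (address_list k l)" using assms(1) by simp
  from nth_address_list[OF this] Cst
  show "trm_loc (address_list k l) c t \<in> {1..k} \<and>
      wf_trm (l (trm_loc (address_list k l) c t)) (trm_proj (address_list k l) t)"
    by simp
qed (use assms(2) in simp)

lemma vars_trm_proj: "vars_trm (trm_proj p t) \<subseteq> {x \<in> vars_trm t. c x = trm_loc p c t}"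
  by (cases t) auto

text \<open>Entry \<open>i\<close> is assembled only from terms located in component
  \<open>i\<close>, and each quantifier of \<phi> contributes at most one quantifier to it. The
  confinement to variables with \<open>c x = i\<close> later makes an element quantifier affect a
  single entry.\<close>

lemma decomp_bound:
  assumes "mso_fm (star_vocab \<sigma> k) (length (subseqs [0..<length (address_list k L)]))
      (length (address_list k l)) \<phi>"
    and "\<And>x. c x \<in> {1..k}"
    and "r \<in> set (decomp k (address_list k l) (union_addresses k L) \<phi> c)" "i \<in> {1..k}"
  shows "fm_bound \<sigma> (L i) (l i) (qdepth \<phi>) {x \<in> free_vars \<phi>. c x = i} (free_set_vars \<phi>) (r i)"
  using assms
proof (induction \<phi> arbitrary: c r i)
  case (Rel P ts)
  show ?case
  proof (cases P)
    case (Inl Q)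
    then have "Q \<in> preds \<sigma>" "length ts = arity \<sigma> Q"
      using Rel.prems(1) by (auto simp: star_vocab_def)
    moreover have "wf_trm (l (trm_loc (address_list k l) c t)) (trm_proj (address_list k l) t)"
      if "t \<in> set ts" for t
      using that Rel.prems by (intro trm_proj_wf) auto
    moreover obtain j where loc: "\<forall>t\<in>set ts. trm_loc (address_list k l) c t = j"
      and r: "r = only j (Rel Q (map (trm_proj (address_list k l)) ts))"
      using Rel.prems(3) Inl by auto
    moreover have "(\<Union>t\<in>set ts. vars_trm (trm_proj (address_list k l) t))
        \<subseteq> {x \<in> \<Union>t\<in>set ts. vars_trm t. c x = j}"
      using loc vars_trm_proj[of "address_list k l" _ c] by fastforce
    ultimately show ?thesis by (simp add: r only_def fm_bound_def)
  next
    case (Inr j)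
    then show ?thesis using Rel.prems(3) by (auto simp: fm_bound_def split: if_splits)
  qed
next
  case (Eq s t)
  then show ?case
    using trm_proj_wf(2)[of k l s c] trm_proj_wf(2)[of k l t c]
      vars_trm_proj[of "address_list k l" s c] vars_trm_proj[of "address_list k l" t c]
    by (auto simp: only_def fm_bound_def split: if_splits)
next
  case (SetCst q t)
  then have "set (union_addresses k L q) \<subseteq> (SIGMA i:{1..k}. {..<L i})"
    by (intro set_union_addresses) simp
  with SetCst show ?case
    using trm_proj_wf(2)[of k l t c] vars_trm_proj[of "address_list k l" t c]
    by (auto simp: only_def fm_bound_def split: if_splits)
next
  case (SetVar X t)
  then show ?case
    using trm_proj_wf(2)[of k l t c] vars_trm_proj[of "address_list k l" t c]
    by (auto simp: only_def fm_bound_def split: if_splits)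
next
  case (Neg \<phi>)
  then show ?case
    using neg_rows_bound[of "decomp k (address_list k l) (union_addresses k L) \<phi> c" k \<sigma> L l
        "qdepth \<phi>" "\<lambda>i. {x \<in> free_vars \<phi>. c x = i}" "free_set_vars \<phi>"]
    by simp
next
  case (Conj \<phi> \<psi>)
  from Conj.prems(3) obtain s t where r: "r = (\<lambda>i. Conj (s i) (t i))"
    and s: "s \<in> set (decomp k (address_list k l) (union_addresses k L) \<phi> c)"
    and t: "t \<in> set (decomp k (address_list k l) (union_addresses k L) \<psi> c)"
    by auto
  show ?case
    using Conj.IH(1)[OF _ Conj.prems(2) s Conj.prems(4)]
      Conj.IH(2)[OF _ Conj.prems(2) t Conj.prems(4)] Conj.prems(1)
    by (auto simp: r fm_bound_def)
next
  case (Ex x \<phi>)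
  from Ex.prems(3) obtain j s where r: "r = s(j := Ex x (s j))" and j: "j \<in> {1..k}"
    and s: "s \<in> set (decomp k (address_list k l) (union_addresses k L) \<phi> (c(x := j)))"
    by (auto simp del: upt_Suc)
  \<comment> \<open>Under \<open>c(x := j)\<close> the variable \<open>x\<close> is located in
    \<open>j\<close>: it is not free in the entries with \<open>i \<noteq> j\<close>, and in entry
    \<open>j\<close> the new quantifier binds it.\<close>
  have "fm_bound \<sigma> (L i) (l i) (qdepth \<phi>) {y \<in> free_vars \<phi>. (c(x := j)) y = i}
      (free_set_vars \<phi>) (s i)"
    using Ex.IH[OF _ _ s Ex.prems(4)] Ex.prems(1,2) j by simp
  then show ?case by (auto simp: r fm_bound_def split: if_splits)
next
  case (ExSet X \<phi>)
  from ExSet.prems(3) obtain s where r: "r = (\<lambda>i. ExSet X (s i))"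
    and s: "s \<in> set (decomp k (address_list k l) (union_addresses k L) \<phi> c)"
    by auto
  show ?case
    using ExSet.IH[OF _ ExSet.prems(2) s ExSet.prems(4)] ExSet.prems(1)
    by (auto simp: r fm_bound_def)
qed simp

section \<open>Semantic correctness of the rows\<close>

text \<open>A single family with its parameters, to be instantiated once for \<open>M\<close> and
  once for \<open>N\<close>.\<close>

locale components =
  fixes \<sigma> :: "'p vocab" and k :: nat and M :: "nat \<Rightarrow> ('p, 'a) frame"
    and A :: "nat \<Rightarrow> 'a set list" and a :: "nat \<Rightarrow> 'a list"
  assumes frame: "i \<in> {1..k} \<Longrightarrow> is_frame \<sigma> (M i)"
    and disjoint: "disjoint_family_on (\<lambda>i. universe (M i)) {1..k}"
    and elements: "i \<in> {1..k} \<Longrightarrow> set (a i) \<subseteq> universe (M i)"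
    and sets: "i \<in> {1..k} \<Longrightarrow> set (A i) \<subseteq> admissible (M i)"
begin

abbreviation "elem_addr \<equiv> address_list k (\<lambda>i. length (a i))"
abbreviation "set_addr \<equiv> union_addresses k (\<lambda>i. length (A i))"

text \<open>The element assignment is common to all components, but each has its own set assignment
  \<open>G i\<close>. The disjoint union sees the unions of the sets \<open>G i X\<close>.\<close>

abbreviation holds ::
  "(nat \<Rightarrow> 'a) \<Rightarrow> (nat \<Rightarrow> nat \<Rightarrow> 'a set) \<Rightarrow> (nat \<Rightarrow> 'p fm) \<Rightarrow> bool" where
  "holds g G r \<equiv> \<forall>i\<in>{1..k}. sat (M i) (A i) (a i) g (G i) (r i)"

lemma component_unique:
  assumes "e \<in> universe (M i)" "e \<in> universe (M j)" "i \<in> {1..k}" "j \<in> {1..k}"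
  shows "i = j"
  using disjoint assms unfolding disjoint_family_on_def by blast

lemma admissible_subset: "i \<in> {1..k} \<Longrightarrow> E \<in> admissible (M i) \<Longrightarrow> E \<subseteq> universe (M i)"
  using frame[of i] by (auto simp: is_frame_def)

lemma mem_UN_component:
  assumes "e \<in> universe (M i)" "i \<in> {1..k}" "\<And>j. j \<in> {1..k} \<Longrightarrow> E j \<subseteq> universe (M j)"
  shows "e \<in> (\<Union>j\<in>{1..k}. E j) \<longleftrightarrow> e \<in> E i"
  using assms component_unique by blast

lemma elements_universe: "set (seq_concat k a) \<subseteq> universe (disjoint_union k M)"
  using elements by (force simp: seq_concat_def disjoint_union_def)

lemma holds_only:
  "i \<in> {1..k} \<Longrightarrow> holds g G (only i \<psi>) \<longleftrightarrow> sat (M i) (A i) (a i) g (G i) \<psi>"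
  by (auto simp: only_def)

lemma holds_neg_rows:
  "(\<exists>r\<in>set (neg_rows k rs). holds g G r) \<longleftrightarrow> \<not> (\<exists>r\<in>set rs. holds g G r)"
proof (induction rs)
  case (Cons r rs)
  have "(\<exists>s\<in>set (neg_rows k (r # rs)). holds g G s) \<longleftrightarrow>
      (\<exists>i\<in>{1..k}. \<exists>s\<in>set (neg_rows k rs). holds g G (only i (Neg (r i))) \<and> holds g G s)"
    by (simp add: atLeastLessThanSuc_atLeastAtMost ball_conj_distrib del: upt_Suc)
  also have "\<dots> \<longleftrightarrow> (\<exists>i\<in>{1..k}. \<not> sat (M i) (A i) (a i) g (G i) (r i)) \<and>
      (\<exists>s\<in>set (neg_rows k rs). holds g G s)"
    using holds_only by auto
  finally show ?case using Cons by auto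
qed simp

lemma trm_val_proj:
  assumes "wf_trm (length elem_addr) t" "\<And>x. c x \<in> {1..k}" "\<And>x. g x \<in> universe (M (c x))"
  shows "trm_val (seq_concat k a) g t = trm_val (a (trm_loc elem_addr c t)) g (trm_proj elem_addr t)"
    and "trm_val (seq_concat k a) g t \<in> universe (M (trm_loc elem_addr c t))"
proof -
  show *: "trm_val (seq_concat k a) g t
      = trm_val (a (trm_loc elem_addr c t)) g (trm_proj elem_addr t)"
    using assms by (cases t) (auto simp: seq_concat_nth length_address_list split_beta)
  show "trm_val (seq_concat k a) g t \<in> universe (M (trm_loc elem_addr c t))"
  proof (cases t)
    case (Var x)
    then show ?thesis using assms by simp
  next
    case (Cst j)
    then have "j < length elem_addr" using assms by simp
    from nth_address_list[OF this] show ?thesis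
      using elements Cst unfolding * by (force intro: nth_mem)
  qed
qed

text \<open>The function \<open>c\<close> records where the values of \<open>g\<close> lie. It is
  generalized in the induction along with \<open>g\<close> and \<open>G\<close>, because a
  quantifier may place its witness in any component.\<close>

lemma sat_decomp:
  assumes "mso_fm (star_vocab \<sigma> k) (length (all_unions (seq_concat k A)))
      (length (seq_concat k a)) \<phi>"
    and "\<And>x. c x \<in> {1..k}" "\<And>x. g x \<in> universe (M (c x))"
    and "\<And>i X. i \<in> {1..k} \<Longrightarrow> G i X \<in> admissible (M i)"
  shows "sat (disjoint_union k M) (all_unions (seq_concat k A)) (seq_concat k a)
        g (\<lambda>X. \<Union>i\<in>{1..k}. G i X) \<phi>
      \<longleftrightarrow> (\<exists>r\<in>set (decomp k elem_addr set_addr \<phi> c). holds g G r)"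
  using assms
proof (induction \<phi> arbitrary: c g G)
  case (Rel P ts)
  have wf: "wf_trm (length elem_addr) t" if "t \<in> set ts" for t
    using Rel.prems(1) that by (simp add: length_address_list)
  note val = trm_val_proj[where c = c and g = g, OF wf Rel.prems(2,3)]
    and loc = trm_proj_wf(1)[where c = c, OF wf Rel.prems(2)]
  let ?vs = "map (trm_val (seq_concat k a) g) ts"
  \<comment> \<open>A tuple in a relation of the union lies within one component, and by
    disjointness the locations of the terms reveal which. For a nullary symbol the condition holds
    for every \<open>i\<close>, in accordance with the union over all components.\<close>
  have at: "set ?vs \<subseteq> universe (M i) \<longleftrightarrow> (\<forall>t\<in>set ts. trm_loc elem_addr c t = i)"
    if "i \<in> {1..k}" for i
  proof
    assume sub: "set ?vs \<subseteq> universe (M i)"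
    show "\<forall>t\<in>set ts. trm_loc elem_addr c t = i"
    proof
      fix t assume t: "t \<in> set ts"
      then have "trm_val (seq_concat k a) g t \<in> universe (M i)" using sub by auto
      then show "trm_loc elem_addr c t = i"
        using val(2)[OF t] loc[OF t] that component_unique by blast
    qed
  qed (use val(2) in auto)
  show ?case
  proof (cases P)
    case (Inl Q)
    then have Q: "Q \<in> preds \<sigma>" using Rel.prems(1) by (auto simp: star_vocab_def)
    have "?vs \<in> interp (M i) Q \<longleftrightarrow> (\<forall>t\<in>set ts. trm_loc elem_addr c t = i) \<and>
        holds g G (only i (Rel Q (map (trm_proj elem_addr) ts)))" if i: "i \<in> {1..k}" for i
    proof (cases "\<forall>t\<in>set ts. trm_loc elem_addr c t = i")
      case True
      then have "?vs = map (trm_val (a i) g) (map (trm_proj elem_addr) ts)"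
        using val(1) by auto
      with True i show ?thesis by (simp only: holds_only sat.simps) simp
    next
      case False
      then have "\<not> set ?vs \<subseteq> universe (M i)" using at[OF i] by simp
      then have "?vs \<notin> interp (M i) Q" using frame[OF i] Q unfolding is_frame_def by blast
      with False show ?thesis by blast
    qed
    then show ?thesis using Inl by (auto simp: disjoint_union_def simp del: upt_Suc)
  next
    case (Inr i)
    then have i: "i \<in> {1..k}" and "length ts = 1"
      using Rel.prems(1) by (auto simp: star_vocab_def)
    then obtain t where ts: "ts = [t]" by (metis One_nat_def length_0_conv length_Suc_conv)
    show ?thesis using at[OF i] Inr by (auto simp: disjoint_union_def ts)
  qed
next
  case (Eq s t)
  then have wf: "wf_trm (length elem_addr) s" "wf_trm (length elem_addr) t"
    by (simp_all add: length_address_list)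
  note val = trm_val_proj[where c = c and g = g, OF wf(1) Eq.prems(2,3)]
      trm_val_proj[where c = c and g = g, OF wf(2) Eq.prems(2,3)]
    and loc = trm_proj_wf(1)[where c = c, OF wf(1) Eq.prems(2)]
      trm_proj_wf(1)[where c = c, OF wf(2) Eq.prems(2)]
  show ?case
  proof (cases "trm_loc elem_addr c s = trm_loc elem_addr c t")
    case True
    then show ?thesis using val(1,3) holds_only[OF loc(1)] by simp
  next
    case False
    then have "trm_val (seq_concat k a) g s \<noteq> trm_val (seq_concat k a) g t"
      using val(2,4) component_unique loc by metis
    with False show ?thesis by simp
  qed
next
  case (SetCst q t)
  then have wf: "wf_trm (length elem_addr) t" and q: "q < length (all_unions (seq_concat k A))"
    by (simp_all add: length_address_list)
  note val = trm_val_proj[where c = c and g = g, OF wf SetCst.prems(2,3)]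
    and loc = trm_proj_wf(1)[where c = c, OF wf SetCst.prems(2)]
  let ?v = "trm_val (seq_concat k a) g t" and ?i = "trm_loc elem_addr c t"
  have addr: "set (set_addr q) \<subseteq> (SIGMA i:{1..k}. {..<length (A i)})"
    using q by (intro set_union_addresses) (simp add: all_unions_def length_address_list)
  \<comment> \<open>A parameter containing the value must belong to the component of that value.
    This justifies the filter on addresses in \<open>decomp\<close>.\<close>
  have at: "fst u = ?i" if u: "u \<in> set (set_addr q)" "?v \<in> A (fst u) ! snd u" for u
  proof -
    have "fst u \<in> {1..k}" "snd u < length (A (fst u))"
      using subsetD[OF addr u(1)] by (simp_all add: Sigma_def split_beta, auto)
    moreover from this have "A (fst u) ! snd u \<subseteq> universe (M (fst u))"
      using sets[of "fst u"] nth_mem[of "snd u" "A (fst u)"] admissible_subset by blast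
    ultimately show ?thesis using u(2) component_unique[OF _ val(2) _ loc] by (meson subsetD)
  qed
  have "?v \<in> all_unions (seq_concat k A) ! q \<longleftrightarrow>
      (\<exists>u\<in>set (set_addr q). ?v \<in> A (fst u) ! snd u)"
    by (simp add: all_unions_nth[OF q] split_beta)
  also have "\<dots> \<longleftrightarrow> (\<exists>u\<in>set (set_addr q). fst u = ?i \<and> ?v \<in> A ?i ! snd u)"
    by (intro bex_cong refl) (metis at)
  also have "\<dots> \<longleftrightarrow> (\<exists>r\<in>set (decomp k elem_addr set_addr (SetCst q t) c). holds g G r)"
    by (auto simp: val(1) holds_only[OF loc, simplified])
  finally show ?case by simp
next
  case (SetVar X t)
  then have wf: "wf_trm (length elem_addr) t" by (simp add: length_address_list)
  note val = trm_val_proj[where c = c and g = g, OF wf SetVar.prems(2,3)]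
    and loc = trm_proj_wf(1)[where c = c, OF wf SetVar.prems(2)]
  have "trm_val (seq_concat k a) g t \<in> (\<Union>i\<in>{1..k}. G i X) \<longleftrightarrow>
      trm_val (seq_concat k a) g t \<in> G (trm_loc elem_addr c t) X"
    using val(2) loc SetVar.prems(4) admissible_subset by (intro mem_UN_component) auto
  then show ?case using val(1) holds_only[OF loc] by simp
next
  case (Neg \<phi>)
  have "sat (disjoint_union k M) (all_unions (seq_concat k A)) (seq_concat k a)
        g (\<lambda>X. \<Union>i\<in>{1..k}. G i X) \<phi>
      \<longleftrightarrow> (\<exists>r\<in>set (decomp k elem_addr set_addr \<phi> c). holds g G r)"
    using Neg.prems by (intro Neg.IH) auto
  then show ?case by (simp only: sat.simps decomp.simps holds_neg_rows)
next
  case (Conj \<phi> \<psi>)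
  have "(\<exists>r\<in>set (decomp k elem_addr set_addr (Conj \<phi> \<psi>) c). holds g G r) \<longleftrightarrow>
      (\<exists>r\<in>set (decomp k elem_addr set_addr \<phi> c). holds g G r) \<and>
      (\<exists>r\<in>set (decomp k elem_addr set_addr \<psi> c). holds g G r)"
    by (simp add: ball_conj_distrib)
  moreover have "sat (disjoint_union k M) (all_unions (seq_concat k A)) (seq_concat k a)
        g (\<lambda>X. \<Union>i\<in>{1..k}. G i X) \<phi>
      \<longleftrightarrow> (\<exists>r\<in>set (decomp k elem_addr set_addr \<phi> c). holds g G r)"
    using Conj.prems by (intro Conj.IH(1)) auto
  moreover have "sat (disjoint_union k M) (all_unions (seq_concat k A)) (seq_concat k a)
        g (\<lambda>X. \<Union>i\<in>{1..k}. G i X) \<psi>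
      \<longleftrightarrow> (\<exists>r\<in>set (decomp k elem_addr set_addr \<psi> c). holds g G r)"
    using Conj.prems by (intro Conj.IH(2)) auto
  ultimately show ?case by (simp only: sat.simps)
next
  case (Ex x \<phi>)
  let ?D = "\<lambda>i. set (decomp k elem_addr set_addr \<phi> (c(x := i)))"
  have row: "(\<exists>e\<in>universe (M i). holds (g(x := e)) G r) \<longleftrightarrow> holds g G (r(i := Ex x (r i)))"
    if i: "i \<in> {1..k}" and r: "r \<in> ?D i" for i r
  proof -
    \<comment> \<open>By \<open>decomp_bound\<close>, the free variables of entry \<open>j\<close>
      are located in \<open>j\<close> under \<open>c(x := i)\<close>, so \<open>x\<close> is not
      among them.\<close>
    have other: "sat (M j) (A j) (a j) (g(x := e)) (G j) (r j) \<longleftrightarrow> sat (M j) (A j) (a j) g (G j) (r j)"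
      if "j \<in> {1..k}" "j \<noteq> i" for j e
    proof -
      have "fm_bound \<sigma> (length (A j)) (length (a j)) (qdepth \<phi>)
          {y \<in> free_vars \<phi>. (c(x := i)) y = j} (free_set_vars \<phi>) (r j)"
        using Ex.prems(1,2) i
        by (intro decomp_bound[OF _ _ r that(1)])
          (simp_all add: length_address_list all_unions_def)
      with that show ?thesis by (intro sat_cong) (auto simp: fm_bound_def)
    qed
    have "holds (g(x := e)) G r \<longleftrightarrow> sat (M i) (A i) (a i) (g(x := e)) (G i) (r i) \<and>
        (\<forall>j\<in>{1..k} - {i}. sat (M j) (A j) (a j) g (G j) (r j))" for e
      using other i by blast
    moreover have "holds g G (r(i := Ex x (r i))) \<longleftrightarrow>
        (\<exists>e\<in>universe (M i). sat (M i) (A i) (a i) (g(x := e)) (G i) (r i)) \<and>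
        (\<forall>j\<in>{1..k} - {i}. sat (M j) (A j) (a j) g (G j) (r j))"
      using i by auto
    ultimately show ?thesis by simp
  qed
  have "sat (disjoint_union k M) (all_unions (seq_concat k A)) (seq_concat k a)
        g (\<lambda>X. \<Union>i\<in>{1..k}. G i X) (Ex x \<phi>) \<longleftrightarrow>
      (\<exists>i\<in>{1..k}. \<exists>e\<in>universe (M i).
        sat (disjoint_union k M) (all_unions (seq_concat k A)) (seq_concat k a)
          (g(x := e)) (\<lambda>X. \<Union>i\<in>{1..k}. G i X) \<phi>)"
    by (simp add: disjoint_union_def)
  also have "\<dots> \<longleftrightarrow> (\<exists>i\<in>{1..k}. \<exists>e\<in>universe (M i). \<exists>r\<in>?D i. holds (g(x := e)) G r)"
    by (intro bex_cong refl Ex.IH) (use Ex.prems in auto)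
  also have "\<dots> \<longleftrightarrow> (\<exists>i\<in>{1..k}. \<exists>r\<in>?D i. holds g G (r(i := Ex x (r i))))"
    using row by blast
  also have "\<dots> \<longleftrightarrow> (\<exists>r\<in>set (decomp k elem_addr set_addr (Ex x \<phi>) c). holds g G r)"
    by (simp add: atLeastLessThanSuc_atLeastAtMost del: upt_Suc)
  finally show ?case .
next
  case (ExSet X \<phi>)
  let ?D = "set (decomp k elem_addr set_addr \<phi> c)"
  let ?E = "{E. \<forall>i\<in>{1..k}. E i \<in> admissible (M i)}"
  let ?upd = "\<lambda>E i. (G i)(X := E i)"
  \<comment> \<open>From right to left, witnesses chosen separately in the components are collected
    into one function \<open>E\<close>.\<close>
  have row: "(\<exists>E\<in>?E. holds g (?upd E) r) \<longleftrightarrow> holds g G (\<lambda>i. ExSet X (r i))" for r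
  proof
    assume "holds g G (\<lambda>i. ExSet X (r i))"
    then have "\<forall>i\<in>{1..k}. \<exists>F. F \<in> admissible (M i) \<and>
        sat (M i) (A i) (a i) g ((G i)(X := F)) (r i)"
      by auto
    then obtain E where "\<forall>i\<in>{1..k}. E i \<in> admissible (M i) \<and>
        sat (M i) (A i) (a i) g ((G i)(X := E i)) (r i)"
      by (rule bchoice[THEN exE])
    then show "\<exists>E\<in>?E. holds g (?upd E) r" by auto
  qed auto
  \<comment> \<open>Updating the combined set assignment amounts to updating every component, so the
    result again has the form required by the induction hypothesis.\<close>
  have upd: "(\<lambda>Y. \<Union>i\<in>{1..k}. G i Y)(X := \<Union>i\<in>{1..k}. E i) = (\<lambda>Y. \<Union>i\<in>{1..k}. ?upd E i Y)" for E
    by (rule ext) simp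
  have "sat (disjoint_union k M) (all_unions (seq_concat k A)) (seq_concat k a)
        g (\<lambda>X. \<Union>i\<in>{1..k}. G i X) (ExSet X \<phi>) \<longleftrightarrow>
      (\<exists>E\<in>?E. sat (disjoint_union k M) (all_unions (seq_concat k A)) (seq_concat k a)
        g (\<lambda>Y. \<Union>i\<in>{1..k}. ?upd E i Y) \<phi>)"
    unfolding upd[symmetric] by (auto simp: disjoint_union_def)
  also have "\<dots> \<longleftrightarrow> (\<exists>E\<in>?E. \<exists>r\<in>?D. holds g (?upd E) r)"
    by (intro bex_cong refl ExSet.IH) (use ExSet.prems in auto)
  also have "\<dots> \<longleftrightarrow> (\<exists>r\<in>?D. holds g G (\<lambda>i. ExSet X (r i)))"
    using row by blast
  also have "\<dots> \<longleftrightarrow> (\<exists>r\<in>set (decomp k elem_addr set_addr (ExSet X \<phi>) c). holds g G r)"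
    by simp
  finally show ?case .
qed simp

text \<open>The right-hand side speaks only about single parametrized components, where the assumed
  equivalences apply.\<close>

lemma models_fusion:
  assumes "fusion_map \<sigma> k f" "1 \<le> k" "sentence \<phi>"
    and \<phi>: "mso_fm \<sigma> (length (all_unions (seq_concat k A))) (length (seq_concat k a)) \<phi>"
  shows "models (fusion \<sigma> k f M, all_unions (seq_concat k A), seq_concat k a) \<phi> \<longleftrightarrow>
    (\<exists>r\<in>set (decomp k elem_addr set_addr (expand f \<phi>) (\<lambda>_. 1)).
      \<forall>i\<in>{1..k}. models (M i, A i, a i) (r i))"
proof -
  have ne: "universe (M i) \<noteq> {}" "admissible (M i) \<noteq> {}" if "i \<in> {1..k}" for i
    using frame[OF that] by (simp_all add: is_frame_def)
  \<comment> \<open>To evaluate a sentence any assignment will do. All variables are sent to one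
    element of component 1, in agreement with the location function
    \<open>\<lambda>_. 1\<close>.\<close>
  obtain e where e: "e \<in> universe (M 1)" using ne(1)[of 1] assms(2) by auto
  obtain E where E: "\<forall>i\<in>{1..k}. E i \<in> admissible (M i)"
    using bchoice[of "{1..k}" "\<lambda>i F. F \<in> admissible (M i)"] ne(2) by blast
  let ?g = "\<lambda>_. e" and ?G = "\<lambda>i _. E i"
  note ex = expand_syntax[OF assms(1) \<phi>]
  have U: "e \<in> universe (disjoint_union k M)"
    using e assms(2) by (auto simp: disjoint_union_def)
  have "admissible (disjoint_union k M) \<noteq> {}"
    using E by (auto simp: disjoint_union_def)
  then have "models (fusion \<sigma> k f M, all_unions (seq_concat k A), seq_concat k a) \<phi> \<longleftrightarrow>
      sat (fusion \<sigma> k f M) (all_unions (seq_concat k A)) (seq_concat k a)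
        ?g (\<lambda>X. \<Union>i\<in>{1..k}. ?G i X) \<phi>"
    using U assms(3) by (intro models_sentence) (auto simp: fusion_def)
  also have "\<dots> \<longleftrightarrow> sat (disjoint_union k M) (all_unions (seq_concat k A)) (seq_concat k a)
        ?g (\<lambda>X. \<Union>i\<in>{1..k}. ?G i X) (expand f \<phi>)"
    using assms(1) \<phi> elements_universe U by (intro sat_fusion) auto
  also have "\<dots> \<longleftrightarrow>
      (\<exists>r\<in>set (decomp k elem_addr set_addr (expand f \<phi>) (\<lambda>_. 1)). holds ?g ?G r)"
    using ex e E assms(2) by (intro sat_decomp) auto
  also have "\<dots> \<longleftrightarrow> (\<exists>r\<in>set (decomp k elem_addr set_addr (expand f \<phi>) (\<lambda>_. 1)).
      \<forall>i\<in>{1..k}. models (M i, A i, a i) (r i))"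
  proof (intro bex_cong ball_cong refl)
    fix r i
    assume r: "r \<in> set (decomp k elem_addr set_addr (expand f \<phi>) (\<lambda>_. 1))" and i: "i \<in> {1..k}"
    have "fm_bound \<sigma> (length (A i)) (length (a i)) (qdepth (expand f \<phi>))
        {x \<in> free_vars (expand f \<phi>). 1 = i} (free_set_vars (expand f \<phi>)) (r i)"
      using ex r i assms(2)
      by (intro decomp_bound[where l = "\<lambda>i. length (a i)" and L = "\<lambda>i. length (A i)"])
        (auto simp: length_address_list all_unions_def)
    then have "sentence (r i)"
      using ex assms(3) by (auto simp: sentence_def fm_bound_def)
    then show "sat (M i) (A i) (a i) ?g (?G i) (r i) \<longleftrightarrow> models (M i, A i, a i) (r i)"
      using ne[OF i] by (intro models_sentence[symmetric])
  qed
  finally show ?thesis .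
qed

end

section \<open>Transfer of equivalence to the fusion\<close>

lemma seq_concat_cong: "(\<And>i. i \<in> {1..k} \<Longrightarrow> s i = t i) \<Longrightarrow> seq_concat k s = seq_concat k t"
  by (auto simp: seq_concat_def intro!: arg_cong[where f = concat])

lemma address_list_cong: "(\<And>i. i \<in> {1..k} \<Longrightarrow> l i = l' i) \<Longrightarrow> address_list k l = address_list k l'"
  unfolding address_list_def by (rule seq_concat_cong) simp

theorem theorem5p23:
  fixes \<sigma> :: "'p vocab"
    and k n :: nat
    and f :: "'p \<Rightarrow> ('p + nat) fm"
    and M :: "nat \<Rightarrow> ('p, 'a) frame" and N :: "nat \<Rightarrow> ('p, 'b) frame"
    and a :: "nat \<Rightarrow> 'a list" and b :: "nat \<Rightarrow> 'b list"
    and A :: "nat \<Rightarrow> 'a set list" and B :: "nat \<Rightarrow> 'b set list"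
  assumes "fusion_map \<sigma> k f"
    and "\<forall>i\<in>{1..k}. mso_henkin \<sigma> (M i)"
    and "\<forall>i\<in>{1..k}. mso_henkin \<sigma> (N i)"
    and "disjoint_family_on (\<lambda>i. universe (M i)) {1..k}"
    and "disjoint_family_on (\<lambda>i. universe (N i)) {1..k}"
    and "\<forall>i\<in>{1..k}. set (a i) \<subseteq> universe (M i)"
    and "\<forall>i\<in>{1..k}. set (b i) \<subseteq> universe (N i)"
    and "\<forall>i\<in>{1..k}. set (A i) \<subseteq> admissible (M i)"
    and "\<forall>i\<in>{1..k}. set (B i) \<subseteq> admissible (N i)"
    and "\<forall>i\<in>{1..k}. mso_equiv \<sigma> n (M i, A i, a i) (N i, B i, b i)"
  shows "mso_equiv \<sigma> n
           (fusion \<sigma> k f M, all_unions (seq_concat k A), seq_concat k a)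
           (fusion \<sigma> k f N, all_unions (seq_concat k B), seq_concat k b)"
proof -
  interpret M: components \<sigma> k M A a
    using assms by unfold_locales (auto simp: mso_henkin_def)
  interpret N: components \<sigma> k N B b
    using assms by unfold_locales (auto simp: mso_henkin_def)
  have len: "length (A i) = length (B i)" "length (a i) = length (b i)" if "i \<in> {1..k}" for i
    using assms(10) that by auto
  \<comment> \<open>Equal lengths give equal addresses, so \<open>decomp\<close> produces literally
    the same rows for both families.\<close>
  then have addr: "M.elem_addr = N.elem_addr"
      "address_list k (\<lambda>i. length (A i)) = address_list k (\<lambda>i. length (B i))"
    by (auto intro: address_list_cong)
  then have set_addr: "M.set_addr = N.set_addr" by (auto simp: union_addresses_def)
  have length_eq: "length (seq_concat k a) = length (seq_concat k b)"
      "length (all_unions (seq_concat k A)) = length (all_unions (seq_concat k B))"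
    using addr by (simp_all add: length_address_list all_unions_def)
  have "models (fusion \<sigma> k f M, all_unions (seq_concat k A), seq_concat k a) \<phi> \<longleftrightarrow>
      models (fusion \<sigma> k f N, all_unions (seq_concat k B), seq_concat k b) \<phi>"
    if \<phi>: "mso_fm \<sigma> (length (all_unions (seq_concat k A))) (length (seq_concat k a)) \<phi>"
      and sen: "sentence \<phi>" and depth: "qdepth \<phi> \<le> n" for \<phi>
  proof (cases "1 \<le> k")
    \<comment> \<open>For \<open>k = 0\<close> both fusions have an empty universe and hence no
      assignments, so both sides model every formula.\<close>
    case False
    then have "\<not> assignment (fusion \<sigma> k f M) g G" "\<not> assignment (fusion \<sigma> k f N) h H" for g G h H
      by (simp_all add: assignment_def fusion_def disjoint_union_def)
    then show ?thesis by simp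
  next
    case True
    note ex = expand_syntax[OF assms(1) \<phi>]
    \<comment> \<open>Every entry of a row is a sentence of depth at most \<open>n\<close> over the
      parameters of its component, so the hypothesis for that component applies.\<close>
    have "models (M i, A i, a i) (r i) \<longleftrightarrow> models (N i, B i, b i) (r i)"
      if r: "r \<in> set (decomp k M.elem_addr M.set_addr (expand f \<phi>) (\<lambda>_. 1))" and i: "i \<in> {1..k}"
      for r i
    proof -
      have "fm_bound \<sigma> (length (A i)) (length (a i)) (qdepth (expand f \<phi>))
          {x \<in> free_vars (expand f \<phi>). 1 = i} (free_set_vars (expand f \<phi>)) (r i)"
        using ex r i True
        by (intro decomp_bound[where l = "\<lambda>i. length (a i)" and L = "\<lambda>i. length (A i)"])
          (auto simp: length_address_list all_unions_def)
      then have "mso_fm \<sigma> (length (A i)) (length (a i)) (r i) \<and> sentence (r i) \<and> qdepth (r i) \<le> n"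
        using ex sen depth by (auto simp: sentence_def fm_bound_def)
      then show ?thesis using assms(10) i by simp
    qed
    then show ?thesis
      using M.models_fusion[OF assms(1) True sen \<phi>]
        N.models_fusion[OF assms(1) True sen \<phi>[unfolded length_eq]] addr(1) set_addr
      by simp
  qed
  then show ?thesis using length_eq by simp
qed

end
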